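(* Let $c$ be a constant. The metric $M_{MDL2}(\mathcal{G},\vec C)=-N\cdot H(\mathcal{G},\vec C)-|E_{\mathcal{G}}|\log N-c\cdot\mathrm{Dim}(\mathcal{G})$, where $N$ is the number of cases in $\vec C$, is score equivalent; that is, for all dags $\mathcal{G},\mathcal{G}'$ over the same set of variables and every database $\vec C$, $\mathcal{G}\approx\mathcal{G}'$ implies $M_{MDL2}(\mathcal{G},\vec C)=M_{MDL2}(\mathcal{G}',\vec C)$.
   Context: All graphs have the same finite vertex set $U=\{x_1,\dots,x_n\}$; a dag $\mathcal{G}=(U,E_{\mathcal{G}})$ is an acyclic directed graph. Each node $x_i$ is a discrete variable with a finite number $r_i\ge 2$ of states. $\Pi_i^{\mathcal{G}}$ denotes the set of parents of $x_i$ in $\mathcal{G}$. A Bayesian network with structure $\mathcal{G}$ is a pair $(\mathcal{G},\theta_{\mathcal{G}})$ where $\theta_{\mathcal{G}}$ is a collection of conditional distributions $p(x_i\mid\Pi_i^{\mathcal{G}})$; it defines the joint distribution $\prod_i p(x_i\mid\Pi_i^{\mathcal{G}})$. Two dags are equivalent, written $\mathcal{G}\approx\mathcal{G}'$, if for every Bayesian network $(\mathcal{G},\theta_{\mathcal{G}})$ there is a Bayesian network $(\mathcal{G}',\theta_{\mathcal{G}'})$ defining the same joint distribution, and vice versa. Known fact (Verma and Pearl): $\mathcal{G}\approx\mathcal{G}'$ if and only if they have the same skeleton (underlying undirected graph) and the same v-structures (ordered triples $(x,y,z)$ of distinct nodes with $x\to y$, $z\to y$ and $x,z$ not adjacent).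 A database $\vec C=\{C_1,\dots,C_N\}$, $N\ge1$, consists of $N$ cases, each a full assignment of states to all variables in $U$. $H(\mathcal{G},\vec C)$ is the entropy associated with parameterizing $\mathcal{G}$ by the observed fractions in the data: $H(\mathcal{G},\vec C)=-\sum_{i}\sum_{j}\sum_{k}\frac{N_{ijk}}{N}\log\frac{N_{ijk}}{N_{ij}}$, where $N_{ijk}$ is the number of cases in which $x_i$ is in state $k$ and $\Pi_i^{\mathcal{G}}$ is in its $j$-th joint configuration, $N_{ij}=\sum_kN_{ijk}$, and terms with $N_{ijk}=0$ are $0$. The number of parameters is $\mathrm{Dim}(\mathcal{G})=\sum_{i=1}^n(r_i-1)\prod_{x_j\in\Pi_i^{\mathcal{G}}}r_j$. *)

theory Defs
  imports Complex_Main "HOL-Library.FuncSet"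
begin

text \<open>
  Throughout, \<open>U\<close> is the finite set of variables, variable \<open>i\<close> has the states
  \<open>{..<r i}\<close>, and a graph is given by its edge set \<open>E\<close>, with \<open>(x, y) \<in> E\<close> for
  the edge \<open>x \<rightarrow> y\<close>.
\<close>

definition dag :: "'v set \<Rightarrow> ('v \<times> 'v) set \<Rightarrow> bool" where
  "dag U E \<longleftrightarrow> E \<subseteq> U \<times> U \<and> acyclic E"

definition parents :: "('v \<times> 'v) set \<Rightarrow> 'v \<Rightarrow> 'v set" where
  "parents E i = {j. (j, i) \<in> E}"

definition configs :: "('v \<Rightarrow> nat) \<Rightarrow> 'v set \<Rightarrow> ('v \<Rightarrow> nat) set" where
  "configs r A = (\<Pi>\<^sub>E i\<in>A. {..<r i})"


text \<open>
  \<open>\<theta> i \<pi> k\<close> is the conditional probability that variable \<open>i\<close> is in state \<open>k\<close>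
  given that its parents are in the joint configuration \<open>\<pi>\<close>. Zero probabilities
  are allowed.
\<close>

type_synonym 'v params = "'v \<Rightarrow> ('v \<Rightarrow> nat) \<Rightarrow> nat \<Rightarrow> real"

definition bayes_net :: "'v set \<Rightarrow> ('v \<Rightarrow> nat) \<Rightarrow> ('v \<times> 'v) set \<Rightarrow> 'v params \<Rightarrow> bool" where
  "bayes_net U r E \<theta> \<longleftrightarrow>
     dag U E \<and>
     (\<forall>i\<in>U. \<forall>\<pi>\<in>configs r (parents E i).
        (\<forall>k<r i. 0 \<le> \<theta> i \<pi> k) \<and> (\<Sum>k<r i. \<theta> i \<pi> k) = 1)"

definition joint :: "'v set \<Rightarrow> ('v \<times> 'v) set \<Rightarrow> 'v params \<Rightarrow> ('v \<Rightarrow> nat) \<Rightarrow> real" where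
  "joint U E \<theta> x = (\<Prod>i\<in>U. \<theta> i (restrict x (parents E i)) (x i))"

definition dag_equiv :: "'v set \<Rightarrow> ('v \<Rightarrow> nat) \<Rightarrow> ('v \<times> 'v) set \<Rightarrow> ('v \<times> 'v) set \<Rightarrow> bool" where
  "dag_equiv U r E E' \<longleftrightarrow>
     (\<forall>\<theta>. bayes_net U r E \<theta> \<longrightarrow>
        (\<exists>\<theta>'. bayes_net U r E' \<theta>' \<and> (\<forall>x\<in>configs r U. joint U E' \<theta>' x = joint U E \<theta> x))) \<and>
     (\<forall>\<theta>'. bayes_net U r E' \<theta>' \<longrightarrow>
        (\<exists>\<theta>. bayes_net U r E \<theta> \<and> (\<forall>x\<in>configs r U. joint U E \<theta> x = joint U E' \<theta>' x)))"


definition database :: "'v set \<Rightarrow> ('v \<Rightarrow> nat) \<Rightarrow> ('v \<Rightarrow> nat) list \<Rightarrow> bool" where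
  "database U r C \<longleftrightarrow> C \<noteq> [] \<and> set C \<subseteq> configs r U"

definition N_ijk :: "('v \<times> 'v) set \<Rightarrow> ('v \<Rightarrow> nat) list \<Rightarrow> 'v \<Rightarrow> ('v \<Rightarrow> nat) \<Rightarrow> nat \<Rightarrow> nat" where
  "N_ijk E C i \<pi> k = length (filter (\<lambda>x. x i = k \<and> restrict x (parents E i) = \<pi>) C)"

definition N_ij :: "('v \<Rightarrow> nat) \<Rightarrow> ('v \<times> 'v) set \<Rightarrow> ('v \<Rightarrow> nat) list \<Rightarrow> 'v \<Rightarrow> ('v \<Rightarrow> nat) \<Rightarrow> nat" where
  "N_ij r E C i \<pi> = (\<Sum>k<r i. N_ijk E C i \<pi> k)"

text \<open>The terms with \<open>N_ijk = 0\<close> vanish because of their first factor.\<close>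

definition entropy_H :: "'v set \<Rightarrow> ('v \<Rightarrow> nat) \<Rightarrow> ('v \<times> 'v) set \<Rightarrow> ('v \<Rightarrow> nat) list \<Rightarrow> real" where
  "entropy_H U r E C =
     - (\<Sum>i\<in>U. \<Sum>\<pi>\<in>configs r (parents E i). \<Sum>k<r i.
          real (N_ijk E C i \<pi> k) / real (length C) *
          ln (real (N_ijk E C i \<pi> k) / real (N_ij r E C i \<pi>)))"

definition Dim :: "'v set \<Rightarrow> ('v \<Rightarrow> nat) \<Rightarrow> ('v \<times> 'v) set \<Rightarrow> nat" where
  "Dim U r E = (\<Sum>i\<in>U. (r i - 1) * (\<Prod>j\<in>parents E i. r j))"

definition M_MDL2 ::
  "'v set \<Rightarrow> ('v \<Rightarrow> nat) \<Rightarrow> real \<Rightarrow> ('v \<times> 'v) set \<Rightarrow> ('v \<Rightarrow> nat) list \<Rightarrow> real" where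
  "M_MDL2 U r c E C =
     - real (length C) * entropy_H U r E C
     - real (card E) * ln (real (length C))
     - c * real (Dim U r E)"

definition score_equivalent ::
  "'v set \<Rightarrow> ('v \<Rightarrow> nat) \<Rightarrow> (('v \<times> 'v) set \<Rightarrow> ('v \<Rightarrow> nat) list \<Rightarrow> real) \<Rightarrow> bool" where
  "score_equivalent U r M \<longleftrightarrow>
     (\<forall>E E' C. dag U E \<longrightarrow> dag U E' \<longrightarrow> database U r C \<longrightarrow>
        dag_equiv U r E E' \<longrightarrow> M E C = M E' C)"

end

theory Submission
  imports Defs
begin

text \<open>
  Equality of the entropies is the maximum likelihood principle: \<open>- N * H\<close> is the largest
  log-likelihood of the data over all networks with the given structure (Gibbs' inequality), and
  equivalent dags offer the same joint distributions.

  For the other two terms no appeal to Verma and Pearl is needed. Say that \<open>T\<close> has a sink clique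
  if some \<open>i \<in> T\<close> has all of \<open>T - {i}\<close> among its parents. Expanding
  \<open>(r i - 1) * (\<Prod>j\<in>parents E i. 1 + (r j - 1))\<close> shows that \<open>Dim\<close> is the sum of
  \<open>\<Prod>j\<in>T. r j - 1\<close> over such sets \<open>T\<close>, and the edges are those of cardinality 2. Whether \<open>T \<noteq> {}\<close> has
  a sink clique depends only on the represented distributions: it holds iff some network with this
  structure has as its support the binary configurations of even parity on \<open>T\<close>.
\<close>

section \<open>Inclusion between families of distributions; positivity of the joint\<close>

definition submodel :: "'v set \<Rightarrow> ('v \<Rightarrow> nat) \<Rightarrow> ('v \<times> 'v) set \<Rightarrow> ('v \<times> 'v) set \<Rightarrow> bool" where
  "submodel U r E E' \<longleftrightarrow>
     (\<forall>\<theta>. bayes_net U r E \<theta> \<longrightarrow>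
        (\<exists>\<theta>'. bayes_net U r E' \<theta>' \<and> (\<forall>x\<in>configs r U. joint U E' \<theta>' x = joint U E \<theta> x)))"

text \<open>The two inclusions are kept apart because each alone yields one inequality between
  entropies and one implication between sink cliques.\<close>

lemma dag_equiv_iff_submodel: "dag_equiv U r E E' \<longleftrightarrow> submodel U r E E' \<and> submodel U r E' E"
  unfolding dag_equiv_def submodel_def by blast

lemma parents_subset: "dag U E \<Longrightarrow> parents E i \<subseteq> U"
  unfolding dag_def parents_def by auto

lemma restrict_parents_in_configs:
  "dag U E \<Longrightarrow> x \<in> configs r U \<Longrightarrow> restrict x (parents E i) \<in> configs r (parents E i)"
  using parents_subset[of U E i] unfolding configs_def
  by (auto simp: PiE_iff)

lemma finite_configs: "finite A \<Longrightarrow> finite (configs r A)"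
  unfolding configs_def by (intro finite_PiE) auto

lemma configsD: "x \<in> configs r U \<Longrightarrow> i \<in> U \<Longrightarrow> x i < r i"
  unfolding configs_def by auto

lemma bayes_net_nonneg:
  assumes "bayes_net U r E \<theta>" "x \<in> configs r U" "i \<in> U"
  shows "0 \<le> \<theta> i (restrict x (parents E i)) (x i)"
  using assms restrict_parents_in_configs[of U E x r i] configsD[of x r U i]
  unfolding bayes_net_def by auto

text \<open>All factors are nonnegative, so the product is positive exactly when none of them
  vanishes.\<close>

lemma joint_pos_iff:
  assumes "finite U" "bayes_net U r E \<theta>" "x \<in> configs r U"
  shows "0 < joint U E \<theta> x \<longleftrightarrow> (\<forall>i\<in>U. 0 < \<theta> i (restrict x (parents E i)) (x i))"
proof
  assume pos: "0 < joint U E \<theta> x"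
  show "\<forall>i\<in>U. 0 < \<theta> i (restrict x (parents E i)) (x i)"
  proof
    fix i assume "i \<in> U"
    moreover from this have "\<theta> i (restrict x (parents E i)) (x i) \<noteq> 0"
      using pos assms(1) unfolding joint_def by (metis less_irrefl prod_zero)
    ultimately show "0 < \<theta> i (restrict x (parents E i)) (x i)"
      using bayes_net_nonneg[OF assms(2,3)] by (metis less_eq_real_def)
  qed
qed (auto simp: joint_def intro: prod_pos)


section \<open>Maximum likelihood\<close>

lemma sum_list_by_configuration:
  fixes f :: "('v \<Rightarrow> nat) \<Rightarrow> nat \<Rightarrow> real"
  assumes "finite U" "dag U E" "i \<in> U" "set C \<subseteq> configs r U"
  shows "(\<Sum>x\<leftarrow>C. f (restrict x (parents E i)) (x i)) =
         (\<Sum>\<pi>\<in>configs r (parents E i). \<Sum>k<r i. real (N_ijk E C i \<pi> k) * f \<pi> k)"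
  using assms(4)
proof (induction C)
  case Nil
  then show ?case by (simp add: N_ijk_def)
next
  case (Cons x C)
  let ?p = "restrict x (parents E i)"
  have p: "?p \<in> configs r (parents E i)"
    using restrict_parents_in_configs[OF assms(2)] Cons.prems by auto
  have k: "x i < r i" using Cons.prems configsD[OF _ assms(3)] by auto
  have fin: "finite (configs r (parents E i))"
    using finite_configs finite_subset[OF parents_subset[OF assms(2)] assms(1)] .
  \<comment> \<open>Prepending \<open>x\<close> raises exactly one count by one. The nested
    conditions let the sums over \<open>k\<close> and \<open>\<pi>\<close> collapse one after the
    other.\<close>
  have "real (N_ijk E (x # C) i \<pi> k) * f \<pi> k =
      (if \<pi> = ?p then if k = x i then f \<pi> k else 0 else 0) + real (N_ijk E C i \<pi> k) * f \<pi> k" for \<pi> k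
    by (auto simp: N_ijk_def algebra_simps)
  then have "(\<Sum>\<pi>\<in>configs r (parents E i). \<Sum>k<r i. real (N_ijk E (x # C) i \<pi> k) * f \<pi> k) =
      (\<Sum>\<pi>\<in>configs r (parents E i). if \<pi> = ?p then (\<Sum>k<r i. if k = x i then f \<pi> k else 0) else 0) +
      (\<Sum>\<pi>\<in>configs r (parents E i). \<Sum>k<r i. real (N_ijk E C i \<pi> k) * f \<pi> k)"
    by (simp add: sum.distrib if_distrib[of "sum _"] flip: sum.distrib cong: if_cong)
       (auto intro!: sum.cong simp: sum.distrib)
  also have "\<dots> = f ?p (x i) + (\<Sum>\<pi>\<in>configs r (parents E i). \<Sum>k<r i. real (N_ijk E C i \<pi> k) * f \<pi> k)"
    using p k fin by (simp add: sum.delta)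
  finally show ?case using Cons.IH Cons.prems by (simp del: restrict_apply)
qed

lemma minus_entropy_eq:
  assumes "C \<noteq> []"
  shows "- real (length C) * entropy_H U r E C =
    (\<Sum>i\<in>U. \<Sum>\<pi>\<in>configs r (parents E i). \<Sum>k<r i.
       real (N_ijk E C i \<pi> k) * ln (real (N_ijk E C i \<pi> k) / real (N_ij r E C i \<pi>)))"
  using assms unfolding entropy_H_def by (simp add: sum_distrib_left sum_negf)

text \<open>Positivity on the data makes every factor positive, so \<open>ln\<close> splits the
  product over variables; then the sums over cases and variables are exchanged.\<close>

lemma sum_list_ln_joint:
  assumes "finite U" "bayes_net U r E \<theta>" "set C \<subseteq> configs r U" "\<And>x. x \<in> set C \<Longrightarrow> 0 < joint U E \<theta> x"
  shows "(\<Sum>x\<leftarrow>C. ln (joint U E \<theta> x)) =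
    (\<Sum>i\<in>U. \<Sum>\<pi>\<in>configs r (parents E i). \<Sum>k<r i. real (N_ijk E C i \<pi> k) * ln (\<theta> i \<pi> k))"
proof -
  have dag: "dag U E" using assms(2) by (simp add: bayes_net_def)
  have "(\<Sum>x\<leftarrow>C. ln (joint U E \<theta> x)) = (\<Sum>x\<leftarrow>C. \<Sum>i\<in>U. ln (\<theta> i (restrict x (parents E i)) (x i)))"
  proof (intro arg_cong[where f = sum_list] map_cong refl)
    fix x assume "x \<in> set C"
    then have "\<forall>i\<in>U. 0 < \<theta> i (restrict x (parents E i)) (x i)"
      using joint_pos_iff[OF assms(1,2), of x] assms(3,4) by blast
    then show "ln (joint U E \<theta> x) = (\<Sum>i\<in>U. ln (\<theta> i (restrict x (parents E i)) (x i)))"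
      unfolding joint_def by (intro ln_prod assms(1)) (metis less_irrefl)
  qed
  also have "\<dots> = (\<Sum>i\<in>U. \<Sum>x\<leftarrow>C. ln (\<theta> i (restrict x (parents E i)) (x i)))"
    by (induction C) (auto simp: sum.distrib)
  also have "\<dots> =
      (\<Sum>i\<in>U. \<Sum>\<pi>\<in>configs r (parents E i). \<Sum>k<r i. real (N_ijk E C i \<pi> k) * ln (\<theta> i \<pi> k))"
    by (intro sum.cong refl sum_list_by_configuration[OF assms(1) dag _ assms(3)])
  finally show ?thesis .
qed

text \<open>Let \<open>S\<close> be the total count and \<open>p = n k / S\<close>. If
  \<open>n k > 0\<close>, then \<open>ln t \<le> t - 1\<close> at \<open>t = q k / p\<close> gives
  \<open>n k * ln (q k / p) \<le> S * q k - n k\<close>; if \<open>n k = 0\<close>, the left side is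
  0 and the right side nonnegative. The right sides add up to \<open>S - S = 0\<close>.\<close>

lemma gibbs_inequality:
  fixes n :: "nat \<Rightarrow> nat" and q :: "nat \<Rightarrow> real"
  assumes "\<And>k. k < m \<Longrightarrow> 0 \<le> q k" "(\<Sum>k<m. q k) = 1" "\<And>k. k < m \<Longrightarrow> 0 < n k \<Longrightarrow> 0 < q k"
  shows "(\<Sum>k<m. real (n k) * ln (q k)) \<le> (\<Sum>k<m. real (n k) * ln (real (n k) / real (\<Sum>k<m. n k)))"
proof -
  let ?S = "\<Sum>k<m. n k"
  have "real (n k) * ln (q k) - real (n k) * ln (real (n k) / real ?S) \<le> real ?S * q k - real (n k)"
    if k: "k < m" for k
  proof (cases "n k = 0")
    case True
    then show ?thesis using assms(1)[OF k] by (simp add: sum_nonneg)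
  next
    case False
    then have n: "0 < n k" and q: "0 < q k" using assms(3)[OF k] by auto
    have "n k \<le> ?S" using k by (intro member_le_sum) auto
    then have S: "0 < ?S" using n by linarith
    have p: "0 < real (n k) / real ?S" using n S by (intro divide_pos_pos) linarith+
    have "ln (q k) - ln (real (n k) / real ?S) = ln (q k / (real (n k) / real ?S))"
      using q p n S by (subst ln_div[of "q k"]) auto
    also have "\<dots> \<le> q k / (real (n k) / real ?S) - 1"
      by (rule ln_le_minus_one[OF divide_pos_pos[OF q p]])
    finally have "real (n k) * (ln (q k) - ln (real (n k) / real ?S))
        \<le> real (n k) * (q k / (real (n k) / real ?S) - 1)"
      by (intro mult_left_mono) auto
    also have "\<dots> = real ?S * q k - real (n k)" using n by (simp add: field_simps)
    finally show ?thesis by (simp only: right_diff_distrib)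
  qed
  then have "(\<Sum>k<m. real (n k) * ln (q k) - real (n k) * ln (real (n k) / real ?S))
      \<le> (\<Sum>k<m. real ?S * q k - real (n k))"
    by (intro sum_mono) auto
  also have "\<dots> = 0"
    using assms(2) by (simp add: sum_subtractf flip: sum_distrib_left)
  finally show ?thesis by (simp add: sum_subtractf)
qed

text \<open>The log-likelihood splits into one piece per variable and parent configuration, and
  Gibbs' inequality bounds each piece.\<close>

lemma log_likelihood_le:
  assumes "finite U" "bayes_net U r E \<theta>" "database U r C" "\<And>x. x \<in> set C \<Longrightarrow> 0 < joint U E \<theta> x"
  shows "(\<Sum>x\<leftarrow>C. ln (joint U E \<theta> x)) \<le> - real (length C) * entropy_H U r E C"
proof -
  have C: "C \<noteq> []" "set C \<subseteq> configs r U" using assms(3) by (auto simp: database_def)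
  have L: "(\<Sum>x\<leftarrow>C. ln (joint U E \<theta> x)) =
      (\<Sum>i\<in>U. \<Sum>\<pi>\<in>configs r (parents E i). \<Sum>k<r i. real (N_ijk E C i \<pi> k) * ln (\<theta> i \<pi> k))"
    by (rule sum_list_ln_joint[OF assms(1,2) C(2) assms(4)])
  show ?thesis
    unfolding minus_entropy_eq[OF C(1)] L N_ij_def
  proof (rule sum_mono, rule sum_mono, rule gibbs_inequality)
    \<comment> \<open>A positive count is witnessed by a case of the data, where the joint
      probability and hence the factor at \<open>i\<close> is positive.\<close>
    fix i \<pi> k assume i: "i \<in> U" and "\<pi> \<in> configs r (parents E i)" "k < r i" "0 < N_ijk E C i \<pi> k"
    then obtain x where "x \<in> set C" "x i = k" "restrict x (parents E i) = \<pi>"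
      by (auto simp: N_ijk_def length_greater_0_conv filter_empty_conv)
    then show "0 < \<theta> i \<pi> k"
      using i joint_pos_iff[OF assms(1,2), of x] assms(4)[of x] C(2) by auto
  qed (use assms(2) in \<open>auto simp: bayes_net_def\<close>)
qed

text \<open>The observed conditional fractions. An unobserved parent configuration gets the point
  mass at state 0, because \<open>0 / 0 = 0\<close> would not give a distribution.\<close>

definition ml_params :: "('v \<Rightarrow> nat) \<Rightarrow> ('v \<times> 'v) set \<Rightarrow> ('v \<Rightarrow> nat) list \<Rightarrow> 'v params" where
  "ml_params r E C i \<pi> k =
     (if N_ij r E C i \<pi> = 0 then if k = 0 then 1 else 0
      else real (N_ijk E C i \<pi> k) / real (N_ij r E C i \<pi>))"

lemma N_ijk_le_N_ij: "k < r i \<Longrightarrow> N_ijk E C i \<pi> k \<le> N_ij r E C i \<pi>"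
  unfolding N_ij_def by (intro member_le_sum) auto

lemma bayes_net_ml_params:
  assumes "dag U E" "\<And>i. i \<in> U \<Longrightarrow> 0 < r i"
  shows "bayes_net U r E (ml_params r E C)"
proof -
  have "(\<Sum>k<r i. ml_params r E C i \<pi> k) = 1" if "i \<in> U" for i \<pi>
  proof (cases "N_ij r E C i \<pi> = 0")
    case True
    then show ?thesis using assms(2)[OF that] by (simp add: ml_params_def sum.delta)
  next
    case False
    then show ?thesis
      by (simp add: ml_params_def flip: sum_divide_distrib) (simp add: N_ij_def flip: of_nat_sum)
  qed
  then show ?thesis using assms(1) by (auto simp: bayes_net_def ml_params_def)
qed

text \<open>Every case of the data contributes to its own counts, so all its observed fractions are
  positive.\<close>

lemma joint_ml_params_pos:
  assumes "finite U" "dag U E" "\<And>i. i \<in> U \<Longrightarrow> 0 < r i" "set C \<subseteq> configs r U" "x \<in> set C"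
  shows "0 < joint U E (ml_params r E C) x"
proof -
  have "0 < ml_params r E C i (restrict x (parents E i)) (x i)" if i: "i \<in> U" for i
  proof -
    have "0 < N_ijk E C i (restrict x (parents E i)) (x i)"
      using assms(5) by (auto simp: N_ijk_def filter_empty_conv)
    moreover have "N_ijk E C i (restrict x (parents E i)) (x i) \<le> N_ij r E C i (restrict x (parents E i))"
      using assms(4,5) configsD[OF _ i] by (intro N_ijk_le_N_ij) auto
    ultimately show ?thesis by (auto simp: ml_params_def)
  qed
  then show ?thesis unfolding joint_def by (intro prod_pos) auto
qed

lemma log_likelihood_ml_params:
  assumes "finite U" "dag U E" "\<And>i. i \<in> U \<Longrightarrow> 0 < r i" "database U r C"
  shows "(\<Sum>x\<leftarrow>C. ln (joint U E (ml_params r E C) x)) = - real (length C) * entropy_H U r E C"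
proof -
  have C: "C \<noteq> []" "set C \<subseteq> configs r U" using assms(4) by (auto simp: database_def)
  \<comment> \<open>The default value does no harm: it occurs only where \<open>N_ij\<close>, hence
    also \<open>N_ijk\<close>, vanishes, and there both sides are 0.\<close>
  have "real (N_ijk E C i \<pi> k) * ln (ml_params r E C i \<pi> k) =
      real (N_ijk E C i \<pi> k) * ln (real (N_ijk E C i \<pi> k) / real (N_ij r E C i \<pi>))"
    if "k < r i" for i \<pi> k
    using N_ijk_le_N_ij[of k r i E C \<pi>, OF that] by (auto simp: ml_params_def)
  then show ?thesis
    unfolding minus_entropy_eq[OF C(1)]
    by (subst sum_list_ln_joint[OF assms(1) bayes_net_ml_params[OF assms(2,3)] C(2)])
       (auto intro!: sum.cong joint_ml_params_pos assms C)
qed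

text \<open>The maximum likelihood distribution for \<open>E\<close> is also represented by
  \<open>E'\<close>, so its likelihood is at most the maximum for \<open>E'\<close>.\<close>

lemma submodel_entropy_le:
  assumes "finite U" "dag U E" "\<And>i. i \<in> U \<Longrightarrow> 0 < r i" "database U r C" "submodel U r E E'"
  shows "- real (length C) * entropy_H U r E C \<le> - real (length C) * entropy_H U r E' C"
proof -
  have C: "set C \<subseteq> configs r U" using assms(4) by (auto simp: database_def)
  obtain \<theta>' where bn: "bayes_net U r E' \<theta>'"
    and eq: "\<And>x. x \<in> configs r U \<Longrightarrow> joint U E' \<theta>' x = joint U E (ml_params r E C) x"
    using assms(5)[unfolded submodel_def, rule_format, OF bayes_net_ml_params[OF assms(2,3)]] by blast
  have "- real (length C) * entropy_H U r E C = (\<Sum>x\<leftarrow>C. ln (joint U E (ml_params r E C) x))"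
    by (rule log_likelihood_ml_params[OF assms(1-4), symmetric])
  also have "\<dots> = (\<Sum>x\<leftarrow>C. ln (joint U E' \<theta>' x))"
    using C eq by (intro arg_cong[where f = sum_list] map_cong) auto
  also have "\<dots> \<le> - real (length C) * entropy_H U r E' C"
  proof (rule log_likelihood_le[OF assms(1) bn assms(4)])
    show "0 < joint U E' \<theta>' x" if "x \<in> set C" for x
      using joint_ml_params_pos[OF assms(1-3) C that] eq[of x] C that by auto
  qed
  finally show ?thesis .
qed


section \<open>Parity distributions\<close>

text \<open>The nodes of \<open>T - {i}\<close> need not be adjacent to each other. As a 0/1
  function of \<open>T\<close> this is the characteristic imset of the dag.\<close>

definition has_sink_clique :: "('v \<times> 'v) set \<Rightarrow> 'v set \<Rightarrow> bool" where
  "has_sink_clique E T \<longleftrightarrow> (\<exists>i\<in>T. T - {i} \<subseteq> parents E i)"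

text \<open>Fair coins on the states 0 and 1, except that \<open>s\<close> is the parity of the
  other members of \<open>T\<close>.\<close>

definition parity_params :: "'v set \<Rightarrow> 'v \<Rightarrow> 'v params" where
  "parity_params T s i \<pi> k =
     (if i = s then if k = (\<Sum>j\<in>T - {s}. \<pi> j) mod 2 then 1 else 0
      else if k < 2 then 1 / 2 else 0)"

lemma bayes_net_parity_params:
  assumes "dag U E" "\<And>i. i \<in> U \<Longrightarrow> 2 \<le> r i"
  shows "bayes_net U r E (parity_params T s)"
proof -
  have "(\<Sum>k<r i. parity_params T s i \<pi> k) = 1" if "i \<in> U" for i \<pi>
  proof -
    have "(\<Sum>k<r i. parity_params T s i \<pi> k) = (\<Sum>k<2. parity_params T s i \<pi> k)"
      using assms(2)[OF that] by (intro sum.mono_neutral_right) (auto simp: parity_params_def)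
    also have "\<dots> = 1"
    proof (cases "i = s")
      case True
      then show ?thesis by (simp add: parity_params_def sum.delta)
    next
      case False
      then show ?thesis by (simp add: parity_params_def)
    qed
    finally show ?thesis .
  qed
  then show ?thesis using assms(1) by (auto simp: bayes_net_def parity_params_def)
qed

text \<open>The factor at \<open>s\<close> forces even parity on \<open>T\<close>, the others force
  binary values. The resulting support mentions neither \<open>s\<close> nor the edges, so it can be
  transferred to another dag.\<close>

lemma joint_parity_params_pos_iff:
  assumes "finite U" "dag U E" "\<And>i. i \<in> U \<Longrightarrow> 2 \<le> r i" "T \<subseteq> U" "s \<in> T" "T - {s} \<subseteq> parents E s"
    and "x \<in> configs r U"
  shows "0 < joint U E (parity_params T s) x \<longleftrightarrow> (\<forall>i\<in>U. x i < 2) \<and> even (\<Sum>j\<in>T. x j)"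
proof -
  have "(\<Sum>j\<in>T - {s}. restrict x (parents E s) j) = (\<Sum>j\<in>T - {s}. x j)"
    using assms(6) by (intro sum.cong) auto
  then have "0 < joint U E (parity_params T s) x \<longleftrightarrow>
      (\<forall>i\<in>U. if i = s then x s = (\<Sum>j\<in>T - {s}. x j) mod 2 else x i < 2)"
    unfolding joint_pos_iff[OF assms(1) bayes_net_parity_params[OF assms(2,3)] assms(7), simplified]
    by (intro ball_cong) (auto simp: parity_params_def)
  also have "\<dots> \<longleftrightarrow> (\<forall>i\<in>U. x i < 2) \<and> x s = (\<Sum>j\<in>T - {s}. x j) mod 2"
    using assms(4,5) by auto
  also have "\<dots> \<longleftrightarrow> (\<forall>i\<in>U. x i < 2) \<and> even (\<Sum>j\<in>T. x j)"
  proof (intro conj_cong refl)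
    have parity: "a = b mod 2 \<longleftrightarrow> even t" if "a < 2" "t = a + b" for a b t :: nat
      using that by presburger
    assume "\<forall>i\<in>U. x i < 2"
    then have "x s < 2" using assms(4,5) by auto
    moreover have "(\<Sum>j\<in>T. x j) = x s + (\<Sum>j\<in>T - {s}. x j)"
      using assms(1,4,5) by (metis finite_subset sum.remove)
    ultimately show "x s = (\<Sum>j\<in>T - {s}. x j) mod 2 \<longleftrightarrow> even (\<Sum>j\<in>T. x j)"
      by (rule parity)
  qed
  finally show ?thesis .
qed

text \<open>Reachability restricted to \<open>T\<close> is finite and acyclic, so its converse is
  well-founded. The transitive closure is used because paths may leave \<open>T\<close> and
  return.\<close>

lemma exists_maximal_vertex:
  assumes "acyclic E" "finite T" "T \<noteq> {}"
  obtains s where "s \<in> T" "\<And>t. t \<in> T \<Longrightarrow> (s, t) \<notin> E\<^sup>+"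
proof -
  let ?R = "{(x, y). x \<in> T \<and> y \<in> T \<and> (x, y) \<in> E\<^sup>+}"
  have "finite ?R" by (rule finite_subset[of _ "T \<times> T"]) (use assms(2) in auto)
  moreover have "acyclic (E\<^sup>+)" using assms(1) by (simp add: acyclic_def)
  then have "acyclic ?R" by (rule acyclic_subset) auto
  ultimately have "wf (?R\<inverse>)" by (rule finite_acyclic_wf_converse)
  moreover obtain t where "t \<in> T" using assms(3) by blast
  ultimately obtain s where "s \<in> T" "\<And>y. (y, s) \<in> ?R\<inverse> \<Longrightarrow> y \<notin> T"
    by (rule wfE_min) blast
  then show thesis by (intro that[of s]) blast+
qed

text \<open>Ancestral sampling: outside the parent-closed set \<open>S\<close> the values of
  \<open>x\<close> are overwritten in topological order, each time by a state of positive
  conditional probability.\<close>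

lemma extend_positive_configuration:
  assumes "finite U" "bayes_net U r E \<theta>" "S \<subseteq> U" "\<And>k. k \<in> S \<Longrightarrow> parents E k \<subseteq> S"
    and "x \<in> configs r U" "\<And>k. k \<in> S \<Longrightarrow> 0 < \<theta> k (restrict x (parents E k)) (x k)"
  shows "\<exists>z\<in>configs r U. (\<forall>k\<in>S. z k = x k) \<and> 0 < joint U E \<theta> z"
  using assms(3-6)
proof (induction "card (U - S)" arbitrary: S x)
  case 0
  then have "S = U" using assms(1) by auto
  then show ?case using 0 joint_pos_iff[OF assms(1,2) 0(4)] by blast
next
  case (Suc n)
  have dag: "dag U E" using assms(2) by (simp add: bayes_net_def)
  then have "acyclic (E\<inverse>)" by (simp add: dag_def)
  moreover have "finite (U - S)" "U - S \<noteq> {}" using Suc.hyps(2) assms(1) by (simp, metis card.empty nat.distinct(1))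
  \<comment> \<open>Maximality for the converse relation means that \<open>i\<close> has no ancestor
    in \<open>U - S\<close>.\<close>
  ultimately obtain i where i: "i \<in> U - S" and min: "\<And>t. t \<in> U - S \<Longrightarrow> (i, t) \<notin> (E\<inverse>)\<^sup>+"
    using exists_maximal_vertex by metis
  have par: "parents E i \<subseteq> S"
  proof
    fix t assume t: "t \<in> parents E i"
    then have "(i, t) \<in> (E\<inverse>)\<^sup>+" by (auto simp: parents_def)
    then show "t \<in> S" using min t parents_subset[OF dag] by blast
  qed
  let ?\<pi> = "restrict x (parents E i)"
  have "(\<Sum>k<r i. \<theta> i ?\<pi> k) = 1"
    using assms(2) i restrict_parents_in_configs[OF dag Suc.prems(3)] by (auto simp: bayes_net_def)
  then obtain k where k: "k < r i" "0 < \<theta> i ?\<pi> k"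
    by (metis lessThan_iff linorder_not_less sum_nonpos zero_less_one)
  let ?y = "x(i := k)"
  \<comment> \<open>All parents in question lie in \<open>S\<close>, and \<open>i\<close> does not,
    so none of these factors sees the change at \<open>i\<close> in its condition.\<close>
  have same: "restrict ?y (parents E j) = restrict x (parents E j)" if "j \<in> insert i S" for j
    using that par Suc.prems(2) i by (auto simp: restrict_def fun_eq_iff)
  have "\<exists>z\<in>configs r U. (\<forall>k\<in>insert i S. z k = ?y k) \<and> 0 < joint U E \<theta> z"
  proof (rule Suc.hyps(1))
    have "U - insert i S = (U - S) - {i}" by blast
    then show "n = card (U - insert i S)" using Suc.hyps(2) i by simp
    show "insert i S \<subseteq> U" using i Suc.prems by auto
    show "?y \<in> configs r U" using Suc.prems(3) k i by (auto simp: configs_def PiE_iff extensional_def)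
    show "parents E j \<subseteq> insert i S" if "j \<in> insert i S" for j
      using that par Suc.prems(2) by auto
    show "0 < \<theta> j (restrict ?y (parents E j)) (?y j)" if "j \<in> insert i S" for j
      using that k Suc.prems(4) i unfolding same[OF that] by auto
  qed
  moreover have "?y j = x j" if "j \<in> S" for j using that i by auto
  ultimately show ?case by (metis insertCI)
qed

text \<open>If \<open>i\<close> is last in \<open>T\<close> and misses a parent \<open>j \<in> T\<close>, its conditional distribution cannot
  see the value of \<open>j\<close>; so flipping \<open>i\<close> alone keeps positive probability but breaks the parity.\<close>

lemma submodel_has_sink_clique:
  assumes "finite U" "dag U E" "dag U E'" "\<And>i. i \<in> U \<Longrightarrow> 2 \<le> r i" "submodel U r E E'"
    and "T \<subseteq> U" "has_sink_clique E T"
  shows "has_sink_clique E' T"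
proof (rule ccontr)
  assume neg: "\<not> has_sink_clique E' T"
  obtain s where s: "s \<in> T" "T - {s} \<subseteq> parents E s" using assms(7) by (auto simp: has_sink_clique_def)
  obtain \<theta> where bn: "bayes_net U r E' \<theta>"
    and "\<And>x. x \<in> configs r U \<Longrightarrow> joint U E' \<theta> x = joint U E (parity_params T s) x"
    using assms(5)[unfolded submodel_def, rule_format, OF bayes_net_parity_params[OF assms(2,4)]] by blast
  then have pos: "0 < joint U E' \<theta> x \<longleftrightarrow> (\<forall>i\<in>U. x i < 2) \<and> even (\<Sum>j\<in>T. x j)"
    if "x \<in> configs r U" for x
    using joint_parity_params_pos_iff[OF assms(1,2,4,6) s that] that by simp
  have fT: "finite T" using assms(1,6) finite_subset by blast
  obtain i where i: "i \<in> T" and max: "\<And>t. t \<in> T \<Longrightarrow> (i, t) \<notin> E'\<^sup>+"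
    using exists_maximal_vertex[of E' T] assms(3) fT s by (auto simp: dag_def)
  obtain j where j: "j \<in> T" "j \<noteq> i" "j \<notin> parents E' i"
    using neg i by (auto simp: has_sink_clique_def)
  \<comment> \<open>Indicator configurations: on \<open>T\<close>, \<open>ind {}\<close> and
    \<open>ind {i, j}\<close> are even, whereas \<open>ind {i}\<close> is odd.\<close>
  define ind where "ind A = restrict (\<lambda>k. if k \<in> A then 1 else 0 :: nat) U" for A
  have ind: "ind A \<in> configs r U" for A
    using assms(4) by (fastforce simp: ind_def configs_def)
  have sum_ind: "(\<Sum>k\<in>T. ind A k) = card (T \<inter> A)" for A
  proof -
    have "(\<Sum>k\<in>T. ind A k) = (\<Sum>k\<in>T. if k \<in> A then 1 else 0)"
      using assms(6) by (intro sum.cong) (auto simp: ind_def)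
    then show ?thesis using fT by (simp add: sum.If_cases)
  qed
  have pos_ind: "0 < \<theta> k (restrict (ind A) (parents E' k)) (ind A k)" if "even (card (T \<inter> A))" "k \<in> U" for A k
    using that pos[OF ind[of A]] joint_pos_iff[OF assms(1) bn ind[of A]]
    by (auto simp: sum_ind) (auto simp: ind_def)
  \<comment> \<open>The non-descendants of \<open>i\<close>, including \<open>i\<close>. Descendants
    may have to react to the flip of \<open>i\<close>, so their values are left to the extension
    lemma.\<close>
  define S where "S = {k \<in> U. (i, k) \<notin> E'\<^sup>+}"
  have TS: "T \<subseteq> S" using assms(6) max by (auto simp: S_def)
  have "\<exists>z\<in>configs r U. (\<forall>k\<in>S. z k = ind {i} k) \<and> 0 < joint U E' \<theta> z"
  proof (rule extend_positive_configuration[OF assms(1) bn _ _ ind])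
    show "S \<subseteq> U" by (auto simp: S_def)
    show "parents E' k \<subseteq> S" if "k \<in> S" for k
      using that parents_subset[OF assms(3), of k] by (auto simp: S_def parents_def intro: trancl_into_trancl)
    show "0 < \<theta> k (restrict (ind {i}) (parents E' k)) (ind {i} k)" if "k \<in> S" for k
    proof (cases "k = i")
      case True
      \<comment> \<open>As \<open>j\<close> is not a parent of \<open>i\<close>, the factor at
        \<open>i\<close> is the same as in the even configuration \<open>ind {i, j}\<close>.\<close>
      have "restrict (ind {i}) (parents E' i) = restrict (ind {i, j}) (parents E' i)" "ind {i} i = ind {i, j} i"
        using j by (auto simp: ind_def restrict_def fun_eq_iff)
      moreover have "T \<inter> {i, j} = {i, j}" using i j by auto
      ultimately show ?thesis using pos_ind[of "{i, j}" i] True i j assms(6) by auto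
    next
      case False
      \<comment> \<open>As \<open>i\<close> is not a parent of \<open>k\<close>, the factor at
        \<open>k\<close> is the same as in the even configuration \<open>ind {}\<close>.\<close>
      then have "restrict (ind {i}) (parents E' k) = restrict (ind {}) (parents E' k)" "ind {i} k = ind {} k"
        using that by (auto simp: ind_def restrict_def fun_eq_iff S_def parents_def)
      then show ?thesis using pos_ind[of "{}" k] that by (simp add: S_def)
    qed
  qed
  then obtain z where z: "z \<in> configs r U" "\<And>k. k \<in> S \<Longrightarrow> z k = ind {i} k" "0 < joint U E' \<theta> z"
    by blast
  have "(\<Sum>k\<in>T. z k) = (\<Sum>k\<in>T. ind {i} k)" using TS z(2) by (intro sum.cong) auto
  also have "\<dots> = 1" using i by (simp add: sum_ind)
  finally show False using pos[OF z(1)] z(3) by simp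
qed


section \<open>Edge count and dimension\<close>

lemma acyclic_no_two_cycle: "acyclic E \<Longrightarrow> (i, j) \<in> E \<Longrightarrow> (j, i) \<notin> E"
  by (meson acyclic_def r_into_trancl' trancl_trans)

text \<open>Multiplying out, \<open>S\<close> collects the factors from which \<open>g j\<close>
  rather than 1 is taken.\<close>

lemma prod_one_plus:
  fixes g :: "'v \<Rightarrow> 'a :: comm_semiring_1"
  assumes "finite A"
  shows "(\<Prod>j\<in>A. 1 + g j) = (\<Sum>S\<in>Pow A. \<Prod>j\<in>S. g j)"
  using assms
proof (induction A)
  case (insert a A)
  have "inj_on (insert a) (Pow A)" using insert by (auto simp: inj_on_def)
  moreover have "(\<Prod>j\<in>insert a S. g j) = g a * (\<Prod>j\<in>S. g j)" if "S \<in> Pow A" for S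
    using that insert finite_subset[of S A] by (subst prod.insert) auto
  moreover have "Pow A \<inter> insert a ` Pow A = {}" using insert by auto
  ultimately show ?case using insert
    by (simp add: Pow_insert sum.union_disjoint sum.reindex distrib_right sum_distrib_left sum.distrib)
qed simp

text \<open>The sink of \<open>T\<close> is unique, since two sinks would be parents of each other.
  Hence \<open>T\<close> determines \<open>i\<close> and \<open>S = T - {i}\<close>.\<close>

lemma bij_betw_sink_cliques:
  assumes "dag U E"
  shows "bij_betw (\<lambda>(i, S). insert i S) (SIGMA i:U. Pow (parents E i)) {T. T \<subseteq> U \<and> has_sink_clique E T}"
proof -
  have ac: "(i, j) \<in> E \<Longrightarrow> (j, i) \<notin> E" for i j
    using assms acyclic_no_two_cycle[of E i j] by (simp add: dag_def)
  have "inj_on (\<lambda>(i, S). insert i S) (SIGMA i:U. Pow (parents E i))"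
  proof (rule inj_onI, clarify)
    fix i S j S' assume *: "S \<subseteq> parents E i" "S' \<subseteq> parents E j" "insert i S = insert j S'"
    have "i = j"
    proof (rule ccontr)
      assume "i \<noteq> j"
      then have "i \<in> S'" "j \<in> S" using *(3) by auto
      then show False using *(1,2) ac by (auto simp: parents_def)
    qed
    moreover have "i \<notin> S" "j \<notin> S'" using *(1,2) ac[of i i] ac[of j j] by (auto simp: parents_def)
    ultimately show "i = j \<and> S = S'" using * by auto
  qed
  moreover have "(\<lambda>(i, S). insert i S) ` (SIGMA i:U. Pow (parents E i)) = {T. T \<subseteq> U \<and> has_sink_clique E T}"
  proof (intro equalityI subsetI)
    fix T assume "T \<in> {T. T \<subseteq> U \<and> has_sink_clique E T}"
    then obtain i where "T \<subseteq> U" "i \<in> T" "T - {i} \<subseteq> parents E i" by (auto simp: has_sink_clique_def)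
    then show "T \<in> (\<lambda>(i, S). insert i S) ` (SIGMA i:U. Pow (parents E i))"
      by (intro image_eqI[of _ _ "(i, T - {i})"]) auto
  qed (use parents_subset[OF assms] in \<open>fastforce simp: has_sink_clique_def\<close>)
  ultimately show ?thesis by (simp add: bij_betw_def)
qed

lemma sum_families_eq_sum_sink_cliques:
  fixes f :: "'v set \<Rightarrow> nat"
  assumes "finite U" "dag U E"
  shows "(\<Sum>i\<in>U. \<Sum>S\<in>Pow (parents E i). f (insert i S)) = (\<Sum>T | T \<subseteq> U \<and> has_sink_clique E T. f T)"
proof -
  have "\<forall>i\<in>U. finite (Pow (parents E i))"
    using assms(1) parents_subset[OF assms(2)] by (metis finite_Pow_iff finite_subset)
  then have "(\<Sum>i\<in>U. \<Sum>S\<in>Pow (parents E i). f (insert i S)) =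
      (\<Sum>p\<in>(SIGMA i:U. Pow (parents E i)). f ((\<lambda>(i, S). insert i S) p))"
    using assms(1) by (simp add: sum.Sigma case_prod_unfold)
  also have "\<dots> = (\<Sum>T | T \<subseteq> U \<and> has_sink_clique E T. f T)"
    by (rule sum.reindex_bij_betw[OF bij_betw_sink_cliques[OF assms(2)]])
  finally show ?thesis .
qed

lemma Dim_eq_sum_sink_cliques:
  assumes "finite U" "dag U E" "\<And>i. i \<in> U \<Longrightarrow> 0 < r i"
  shows "Dim U r E = (\<Sum>T | T \<subseteq> U \<and> has_sink_clique E T. \<Prod>j\<in>T. r j - 1)"
proof -
  have "(r i - 1) * (\<Prod>j\<in>parents E i. r j) = (\<Sum>S\<in>Pow (parents E i). \<Prod>j\<in>insert i S. r j - 1)"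
    if "i \<in> U" for i
  proof -
    have P: "parents E i \<subseteq> U" "finite (parents E i)" "i \<notin> parents E i"
      using parents_subset[OF assms(2)] finite_subset[OF _ assms(1)] assms(2) acyclic_no_two_cycle[of E i i]
      by (auto simp: dag_def parents_def)
    \<comment> \<open>Subtraction is truncated on naturals; positivity of \<open>r j\<close> makes
      this rewriting valid.\<close>
    have "(\<Prod>j\<in>parents E i. r j) = (\<Prod>j\<in>parents E i. 1 + (r j - 1))"
      using P(1) assms(3) by (intro prod.cong) force+
    also have "\<dots> = (\<Sum>S\<in>Pow (parents E i). \<Prod>j\<in>S. r j - 1)" by (rule prod_one_plus[OF P(2)])
    finally have "(r i - 1) * (\<Prod>j\<in>parents E i. r j) = (\<Sum>S\<in>Pow (parents E i). (r i - 1) * (\<Prod>j\<in>S. r j - 1))"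
      by (simp add: sum_distrib_left)
    \<comment> \<open>As \<open>i\<close> is not its own parent, \<open>r i - 1\<close> becomes the
      factor of the new element \<open>i\<close>.\<close>
    also have "\<dots> = (\<Sum>S\<in>Pow (parents E i). \<Prod>j\<in>insert i S. r j - 1)"
      using P finite_subset by (intro sum.cong refl) (subst prod.insert; blast)
    finally show ?thesis .
  qed
  then show ?thesis
    unfolding Dim_def sum_families_eq_sum_sink_cliques[OF assms(1,2), symmetric] by simp
qed

text \<open>A pair of nodes has a sink exactly when an edge joins them, and acyclicity excludes both
  orientations at once.\<close>

lemma card_edges_eq_card_sink_cliques:
  assumes "dag U E"
  shows "card E = card {T. T \<subseteq> U \<and> has_sink_clique E T \<and> card T = 2}"
proof (rule bij_betw_same_card[of "\<lambda>(i, j). {i, j}"])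
  have ac: "(i, j) \<in> E \<Longrightarrow> (j, i) \<notin> E" for i j
    using assms acyclic_no_two_cycle[of E i j] by (simp add: dag_def)
  have "inj_on (\<lambda>(i, j). {i, j}) E"
    using ac by (auto simp: inj_on_def doubleton_eq_iff)
  moreover have "(\<lambda>(i, j). {i, j}) ` E = {T. T \<subseteq> U \<and> has_sink_clique E T \<and> card T = 2}"
  proof (intro equalityI subsetI)
    fix T assume "T \<in> (\<lambda>(i, j). {i, j}) ` E"
    then obtain i j where T: "T = {i, j}" "(i, j) \<in> E" by auto
    then have "i \<noteq> j" using ac by auto
    then show "T \<in> {T. T \<subseteq> U \<and> has_sink_clique E T \<and> card T = 2}"
      using T assms by (auto simp: dag_def has_sink_clique_def parents_def)
  next
    fix T assume "T \<in> {T. T \<subseteq> U \<and> has_sink_clique E T \<and> card T = 2}"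
    then obtain i j where "T = {i, j}" "i \<noteq> j" "has_sink_clique E T" by (auto simp: card_2_iff)
    then have "(i, j) \<in> E \<or> (j, i) \<in> E" by (auto simp: has_sink_clique_def parents_def)
    then show "T \<in> (\<lambda>(i, j). {i, j}) ` E"
      using \<open>T = {i, j}\<close> by (auto simp: insert_commute image_iff)
  qed
  ultimately show "bij_betw (\<lambda>(i, j). {i, j}) E {T. T \<subseteq> U \<and> has_sink_clique E T \<and> card T = 2}"
    by (simp add: bij_betw_def)
qed

theorem theorem7:
  fixes U :: "'v set" and r :: "'v \<Rightarrow> nat" and c :: real
  assumes "finite U"
    and "\<And>i. i \<in> U \<Longrightarrow> 2 \<le> r i"
  shows "score_equivalent U r (M_MDL2 U r c)"
  unfolding score_equivalent_def
proof (intro allI impI)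
  fix E E' C
  assume dag: "dag U E" "dag U E'" and C: "database U r C" and "dag_equiv U r E E'"
  then have sub: "submodel U r E E'" "submodel U r E' E" by (simp_all add: dag_equiv_iff_submodel)
  have r: "0 < r i" if "i \<in> U" for i using assms(2)[OF that] by simp
  \<comment> \<open>Each inclusion gives one of the two inequalities.\<close>
  have H: "- real (length C) * entropy_H U r E C = - real (length C) * entropy_H U r E' C"
    by (intro antisym submodel_entropy_le assms(1) dag sub C r)
  have clique: "has_sink_clique E T \<longleftrightarrow> has_sink_clique E' T" if "T \<subseteq> U" for T
    using submodel_has_sink_clique[OF assms(1) dag assms(2) sub(1) that]
      submodel_has_sink_clique[OF assms(1) dag(2,1) assms(2) sub(2) that] by blast
  have "{T. T \<subseteq> U \<and> has_sink_clique E T} = {T. T \<subseteq> U \<and> has_sink_clique E' T}"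
    using clique by blast
  then have D: "Dim U r E = Dim U r E'"
    by (simp add: Dim_eq_sum_sink_cliques[OF assms(1) _ r] dag)
  have "{T. T \<subseteq> U \<and> has_sink_clique E T \<and> card T = 2} = {T. T \<subseteq> U \<and> has_sink_clique E' T \<and> card T = 2}"
    using clique by blast
  then have "card E = card E'" by (simp add: card_edges_eq_card_sink_cliques[OF dag(1)]
        card_edges_eq_card_sink_cliques[OF dag(2)])
  then show "M_MDL2 U r c E C = M_MDL2 U r c E' C"
    using H D unfolding M_MDL2_def by simp
qed

end
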